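(* For every integer $n\ge 1$, the eigentime identity $H(\Gamma_n)$ for random walks on the $n$-cube $\Gamma_n$ is given by $$H(\Gamma_n) = \sum_{k=1}^{n}\frac{n\binom{n}{k}}{2k}.$$
   Context: For $n\ge 1$, let $G_n = \mathbb{Z}_2^n$ and $S_n = \{(x_1,\dots,x_n)\in G_n : \text{exactly one } x_i \text{ equals } 1\}$. The $n$-cube $\Gamma_n = \mathrm{Cay}(G_n,S_n)$ is the simple undirected graph with vertex set $G_n$ in which $g$ and $g'$ are adjacent iff $g' = g+s$ for some $s\in S_n$; it is connected, has $2^n$ vertices and is $n$-regular. For a finite connected simple graph $\Gamma$ with vertices $1,\dots,N$ and edge set $E(\Gamma)$, consider the simple random walk (at each step move to a uniformly random neighbour). Let $H_{ij}$ be the mean first-passage time from $i$ to $j$, i.e. the expected number of steps for a walk started at $i$ to arrive at $j$ for the first time, with $H_{jj}=0$. Let $\pi_j = d_j/(2|E(\Gamma)|)$ be the stationary distribution, where $d_j$ is the degree of $j$. The eigentime identity for random walks on $\Gamma$ is the number $H(\Gamma) = \sum_{j=1}^{N}\pi_j H_{ij}$, which is independent of the starting vertex $i$. *)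

theory Defs
  imports
    "HOL-Probability.Probability"
    "HOL-Algebra.Product_Groups"
    "Graph_Theory.Graph_Theory"
begin

section \<open>Cayley graphs and the n-cube\<close>

text \<open>
  An undirected simple graph is a symmetric loop-free digraph (locale \<^locale>\<open>pair_graph\<close>): every
  edge is represented by the two opposite arcs between its end points.
\<close>

definition cayley_graph :: "('a, 'b) monoid_scheme \<Rightarrow> 'a set \<Rightarrow> 'a pair_pre_digraph" where
  "cayley_graph G S =
     \<lparr> pverts = carrier G,
       parcs = {(g, g'). g \<in> carrier G \<and> g' \<in> carrier G \<and> (\<exists>s\<in>S. g' = g \<otimes>\<^bsub>G\<^esub> s)} \<rparr>"

definition cube_group :: "nat \<Rightarrow> (nat \<Rightarrow> int) monoid" where
  "cube_group n = product_group {1..n} (\<lambda>_. integer_mod_group 2)"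

definition cube_gens :: "nat \<Rightarrow> (nat \<Rightarrow> int) set" where
  "cube_gens n = {x \<in> carrier (cube_group n). \<exists>!i. i \<in> {1..n} \<and> x i = 1}"

definition cube_graph :: "nat \<Rightarrow> (nat \<Rightarrow> int) pair_pre_digraph" where
  "cube_graph n = cayley_graph (cube_group n) (cube_gens n)"

lemma pair_graph_cube_graph: "pair_graph (cube_graph n)"
proof -
  have car: "carrier (cube_group n) = (\<Pi>\<^sub>E i\<in>{1..n}. {0..<2})"
    by (simp add: cube_group_def carrier_integer_mod_group)
  have mult: "x \<otimes>\<^bsub>cube_group n\<^esub> y = (\<lambda>i\<in>{1..n}. (x i + y i) mod 2)" for x y
    by (simp add: cube_group_def)
  have fin: "finite (carrier (cube_group n))"
    unfolding car by (intro finite_PiE) auto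
  have sub: "parcs (cube_graph n) \<subseteq> carrier (cube_group n) \<times> carrier (cube_group n)"
    by (auto simp: cube_graph_def cayley_graph_def)
  have inv: "g = (g \<otimes>\<^bsub>cube_group n\<^esub> s) \<otimes>\<^bsub>cube_group n\<^esub> s"
    if "g \<in> carrier (cube_group n)" for g s
  proof
    fix i
    show "g i = ((g \<otimes>\<^bsub>cube_group n\<^esub> s) \<otimes>\<^bsub>cube_group n\<^esub> s) i"
    proof (cases "i \<in> {1..n}")
      case True
      then have "g i \<in> {0..<2}" using that unfolding car by (rule PiE_mem[rotated])
      moreover have "((g i + s i) mod 2 + s i) mod 2 = g i mod 2" by presburger
      ultimately show ?thesis using True by (simp add: mult)
    next
      case False
      then show ?thesis using that by (auto simp: mult car PiE_iff extensional_def)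
    qed
  qed
  have noloop: "g \<noteq> g \<otimes>\<^bsub>cube_group n\<^esub> s"
    if g: "g \<in> carrier (cube_group n)" and s: "s \<in> cube_gens n" for g s
  proof
    assume eq: "g = g \<otimes>\<^bsub>cube_group n\<^esub> s"
    from s obtain i where i: "i \<in> {1..n}" "s i = 1" unfolding cube_gens_def by blast
    have "g i = (g i + 1) mod 2"
      using fun_cong[OF eq, of i] i by (simp add: mult)
    then show False by presburger
  qed
  show ?thesis
  proof unfold_locales
    show "finite (pverts (cube_graph n))"
      using fin by (simp add: cube_graph_def cayley_graph_def)
    show "finite (parcs (cube_graph n))"
      using finite_subset[OF sub] fin by blast
    show "symmetric (with_proj (cube_graph n))"
    proof -
      have "sym (parcs (cube_graph n))"
        unfolding sym_def using inv by (fastforce simp: cube_graph_def cayley_graph_def)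
      then show ?thesis by (simp add: symmetric_def)
    qed
  qed (use sub noloop in \<open>auto simp: cube_graph_def cayley_graph_def\<close>)
qed


section \<open>Simple random walk\<close>

text \<open>
  Law of the position at time \<open>t\<close> given the trajectory \<open>\<omega>\<close> before time \<open>t\<close>. In graphs with an
  isolated vertex or with infinite degrees, \<^const>\<open>pmf_of_set\<close> is unspecified there.
\<close>

definition walk_kernel ::
    "'a pair_pre_digraph \<Rightarrow> 'a \<Rightarrow> nat \<Rightarrow> (nat \<Rightarrow> 'a) \<Rightarrow> 'a measure" where
  "walk_kernel G i t \<omega> = measure_pmf
     (case t of 0 \<Rightarrow> return_pmf i | Suc s \<Rightarrow> pmf_of_set {w. (\<omega> s, w) \<in> parcs G})"

interpretation walk: Ionescu_Tulcea "walk_kernel G i" "\<lambda>_. count_space UNIV"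
  for G :: "'a pair_pre_digraph" and i :: 'a
proof (rule Ionescu_Tulcea.intro)
  fix t
  show "walk_kernel G i t \<in>
    measurable (PiM {0..<t} (\<lambda>_. count_space UNIV)) (subprob_algebra (count_space UNIV))"
  proof (cases t)
    case 0
    then show ?thesis
      by (auto simp: walk_kernel_def[abs_def] space_subprob_algebra prob_space_imp_subprob_space
          prob_space_measure_pmf intro!: measurable_const)
  next
    case (Suc s)
    have 1: "(\<lambda>\<omega>. \<omega> s) \<in> measurable (PiM {0..<t} (\<lambda>_. count_space UNIV)) (count_space UNIV)"
      using Suc by (intro measurable_component_singleton) auto
    have 2: "(\<lambda>v. measure_pmf (pmf_of_set {w. (v, w) \<in> parcs G}))
      \<in> measurable (count_space UNIV) (subprob_algebra (count_space UNIV))"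
      by (auto simp: space_subprob_algebra prob_space_imp_subprob_space prob_space_measure_pmf)
    show ?thesis
      using measurable_compose[OF 1 2] Suc by (simp add: walk_kernel_def[abs_def])
  qed
qed (simp add: walk_kernel_def prob_space_measure_pmf)

text \<open>The law of the infinite trajectory of the walk started at \<open>i\<close>.\<close>

definition walk_measure :: "'a pair_pre_digraph \<Rightarrow> 'a \<Rightarrow> (nat \<Rightarrow> 'a) measure" where
  "walk_measure G i = walk.PF.lim G i"

text \<open>Since \<open>Inf {} = \<infinity>\<close> in \<^typ>\<open>ennreal\<close>, this is \<open>\<infinity>\<close> on trajectories that never visit \<open>j\<close>.\<close>

definition first_passage :: "'a \<Rightarrow> (nat \<Rightarrow> 'a) \<Rightarrow> ennreal" where
  "first_passage j \<omega> = (INF t\<in>{t. \<omega> t = j}. of_nat t)"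

definition mean_first_passage :: "'a pair_pre_digraph \<Rightarrow> 'a \<Rightarrow> 'a \<Rightarrow> ennreal" where
  "mean_first_passage G i j = (\<integral>\<^sup>+ \<omega>. first_passage j \<omega> \<partial>walk_measure G i)"

definition undirected_edges :: "'a pair_pre_digraph \<Rightarrow> 'a set set" where
  "undirected_edges G = {{u, v} | u v. (u, v) \<in> parcs G}"

definition stationary :: "'a pair_pre_digraph \<Rightarrow> 'a \<Rightarrow> real" where
  "stationary G j = real (out_degree G j) / (2 * real (card (undirected_edges G)))"

text \<open>
  The eigentime identity computed from the starting vertex \<open>i\<close>; its value does not depend on \<open>i\<close>
  for finite connected simple graphs.
\<close>

definition eigentime :: "'a pair_pre_digraph \<Rightarrow> 'a \<Rightarrow> ennreal" where
  "eigentime G i = (\<Sum>j\<in>pverts G. ennreal (stationary G j) * mean_first_passage G i j)"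

end

theory Submission
  imports Defs
begin

text \<open>
  A nonnegative function \<open>h\<close> on the vertices with \<open>h j = 0\<close> and \<open>h v = 1 + (average of h over the
  neighbours of v)\<close> elsewhere is the mean first-passage time to \<open>j\<close>: writing \<open>X\<^sub>t\<close> for the
  position and \<open>T\<close> for the hitting time, the step equation gives
  \<open>(\<Sum>s<t. P(T > s)) + E[h(X\<^sub>t); T > t] = h i\<close>, and the second term vanishes in the limit because
  \<open>h\<close> is bounded and the partial sums force \<open>P(T > t) \<longlongrightarrow> 0\<close>. On the cube such an \<open>h\<close> is explicit in
  terms of the characters \<open>\<chi>\<^sub>S\<close> of \<open>\<int>\<^sub>2\<^sup>n\<close>, because \<open>\<chi>\<^sub>S\<close> is an eigenfunction of the walk with
  eigenvalue \<open>1 - 2 |S| / n\<close>: one has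
  \<open>h v = (\<Sum>S \<noteq> {}. n / (2 |S|) * (1 - \<chi>\<^sub>S v * \<chi>\<^sub>S j))\<close>. Averaging over \<open>j\<close> kills every nontrivial
  character.
\<close>

section \<open>Mean first-passage times from the one-step equation\<close>

text \<open>The preimage of \<open>X\<close> under restriction is the cylinder over
  \<open>X\<close>, whose measure under the limit is fixed by the extension theorem. So integrals
  over infinite trajectories reduce to finite compositions of kernels.\<close>

lemma (in Ionescu_Tulcea) distr_lim_restrict:
  "distr PF.lim (PiM {0..<n} M) (\<lambda>\<omega>. restrict \<omega> {0..<n}) = C 0 n (\<lambda>_. undefined)"
proof (rule measure_eqI)
  have u: "(\<lambda>_. undefined) \<in> space (PiM {0..<0} M)"
    by (simp add: space_PiM)
  show "sets (distr PF.lim (PiM {0..<n} M) (\<lambda>\<omega>. restrict \<omega> {0..<n})) = sets (C 0 n (\<lambda>_. undefined))"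
    using sets_C[OF u, of n] by simp
  fix X assume "X \<in> sets (distr PF.lim (PiM {0..<n} M) (\<lambda>\<omega>. restrict \<omega> {0..<n}))"
  then have X: "X \<in> sets (PiM {0..<n} M)" by simp
  have "(\<lambda>\<omega>. restrict \<omega> {0..<n}) \<in> measurable PF.lim (PiM {0..<n} M)"
    using measurable_restrict_subset[of "{0..<n}" UNIV M] by (simp cong: measurable_cong_sets)
  then have "emeasure (distr PF.lim (PiM {0..<n} M) (\<lambda>\<omega>. restrict \<omega> {0..<n})) X =
      emeasure PF.lim (PF.emb UNIV {0..<n} X)"
    using X by (simp add: emeasure_distr prod_emb_def space_PiM)
  also have "\<dots> = C 0 n (\<lambda>_. undefined) (PF.emb {0..<n} {0..<n} X)"
    using X by (simp add: lim emeasure_CI)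
  also have "PF.emb {0..<n} {0..<n} X = X"
    using sets.sets_into_space[OF X] by (intro prod_emb_id) (auto simp: space_PiM)
  finally show "emeasure (distr PF.lim (PiM {0..<n} M) (\<lambda>\<omega>. restrict \<omega> {0..<n})) X =
      emeasure (C 0 n (\<lambda>_. undefined)) X" .
qed

lemma (in Ionescu_Tulcea) nn_integral_lim_restrict:
  assumes "f \<in> borel_measurable (PiM {0..<n} M)"
  shows "(\<integral>\<^sup>+\<omega>. f (restrict \<omega> {0..<n}) \<partial>PF.lim) = (\<integral>\<^sup>+\<omega>. f \<omega> \<partial>C 0 n (\<lambda>_. undefined))"
proof -
  have "(\<lambda>\<omega>. restrict \<omega> {0..<n}) \<in> measurable PF.lim (PiM {0..<n} M)"
    using measurable_restrict_subset[of "{0..<n}" UNIV M] by (simp cong: measurable_cong_sets)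
  then show ?thesis
    using assms by (simp add: distr_lim_restrict[symmetric] nn_integral_distr)
qed

text \<open>By construction \<open>C 0 (Suc n)\<close> is \<open>C 0 n\<close> bound with the kernel
  at time \<open>n\<close>. Passing to finite marginals and back leaves only the limit measure on
  both sides.\<close>

lemma (in Ionescu_Tulcea) nn_integral_lim_Suc:
  assumes f: "f \<in> borel_measurable (PiM {0..<Suc n} M)"
  shows "(\<integral>\<^sup>+\<omega>. f (restrict \<omega> {0..<Suc n}) \<partial>PF.lim) =
    (\<integral>\<^sup>+\<omega>. \<integral>\<^sup>+x. f ((restrict \<omega> {0..<n})(n := x)) \<partial>P n (restrict \<omega> {0..<n}) \<partial>PF.lim)"
proof -
  have u: "(\<lambda>_. undefined) \<in> space (PiM {0..<0} M)"
    by (simp add: space_PiM)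
  have sC: "space (C 0 n (\<lambda>_. undefined)) = space (PiM {0..<n} M)"
    "sets (C 0 n (\<lambda>_. undefined)) = sets (PiM {0..<n} M)"
    using space_C[OF u, of n] sets_C[OF u, of n] by simp_all
  have eP: "(\<lambda>\<omega>. \<integral>\<^sup>+x. f x \<partial>eP n \<omega>) \<in> borel_measurable (PiM {0..<n} M)"
    by (rule nn_integral_measurable_subprob_algebra2[OF _ measurable_eP]) (use f in simp)
  have "(\<integral>\<^sup>+\<omega>. f (restrict \<omega> {0..<Suc n}) \<partial>PF.lim) =
      (\<integral>\<^sup>+\<omega>. f \<omega> \<partial>C 0 (Suc n) (\<lambda>_. undefined))"
    by (rule nn_integral_lim_restrict[OF f])
  also have "\<dots> = (\<integral>\<^sup>+\<omega>. \<integral>\<^sup>+x. f x \<partial>eP n \<omega> \<partial>C 0 n (\<lambda>_. undefined))"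
    using measurable_eP[of n]
    by (simp add: nn_integral_bind[OF f] sC cong: measurable_cong_sets)
  also have "\<dots> = (\<integral>\<^sup>+\<omega>. \<integral>\<^sup>+x. f x \<partial>eP n (restrict \<omega> {0..<n}) \<partial>PF.lim)"
    by (rule nn_integral_lim_restrict[OF eP, symmetric])
  also have "\<dots> = (\<integral>\<^sup>+\<omega>. \<integral>\<^sup>+x. f ((restrict \<omega> {0..<n})(n := x)) \<partial>P n (restrict \<omega> {0..<n}) \<partial>PF.lim)"
    by (intro nn_integral_cong nn_integral_eP f) (auto simp: space_PiM)
  finally show ?thesis .
qed

section \<open>Law of the walk: measurability, start and Markov property\<close>

lemma space_walk_measure [simp]: "space (walk_measure G i) = UNIV"
  by (simp add: walk_measure_def space_PiM)

lemma sets_walk_measure [measurable_cong]: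
  "sets (walk_measure G i) = sets (PiM UNIV (\<lambda>_. count_space UNIV))"
  by (simp add: walk_measure_def)

lemma measurable_walk_measure:
  assumes "f \<in> measurable (count_space UNIV) N"
  shows "(\<lambda>\<omega>. f (\<omega> t)) \<in> measurable (walk_measure G i) N"
proof -
  have "(\<lambda>\<omega>. \<omega> t) \<in> measurable (walk_measure G i) (count_space UNIV)"
    unfolding measurable_cong_sets[OF sets_walk_measure refl]
    by (rule measurable_component_singleton) simp
  then show ?thesis using assms by (rule measurable_compose)
qed

lemma sets_walk_measure_avoid: "{\<omega>. \<forall>t\<le>s. \<omega> t \<noteq> j} \<in> sets (walk_measure G i)"
proof -
  have "Measurable.pred (walk_measure G i) (\<lambda>\<omega>. \<forall>t\<in>{..s}. \<omega> t \<noteq> j)"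
    by (intro pred_intros_finite measurable_walk_measure) auto
  then show ?thesis by (simp add: pred_def Ball_def)
qed

lemma prob_space_walk_measure: "prob_space (walk_measure G i)"
proof
  have "emeasure (walk_measure G i) (space (walk_measure G i)) = (\<integral>\<^sup>+\<omega>. 1 \<partial>walk.PF.lim G i)"
    by (simp only: walk_measure_def nn_integral_const mult_1)
  \<comment> \<open>A constant depends on no coordinate, so length 0 suffices: \<open>C 0 0\<close>
    is the point mass at the empty trajectory.\<close>
  also have "\<dots> = (\<integral>\<^sup>+\<omega>. 1 \<partial>walk.C G i 0 0 (\<lambda>_. undefined))"
    by (rule walk.nn_integral_lim_restrict) simp
  also have "\<dots> = 1"
    by (simp add: space_PiM sets_PiM_empty)
  finally show "emeasure (walk_measure G i) (space (walk_measure G i)) = 1" .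
qed

lemma AE_walk_measure_start: "AE \<omega> in walk_measure G i. \<omega> 0 = i"
proof -
  have [measurable]: "(\<lambda>\<omega>. indicator (- {i}) (\<omega> 0) :: ennreal)
      \<in> borel_measurable (PiM I (\<lambda>_. count_space UNIV))" if "0 \<in> I" for I
    by (rule measurable_compose[OF measurable_component_singleton[OF that]]) auto
  have "(\<integral>\<^sup>+\<omega>. indicator (- {i}) (\<omega> 0) \<partial>walk_measure G i) = (0::ennreal)"
    using walk.nn_integral_lim_Suc[of "\<lambda>\<omega>. indicator (- {i}) (\<omega> 0)" 0 G i]
    by (simp add: walk_measure_def walk_kernel_def)
  then have "AE \<omega> in walk_measure G i. indicator (- {i}) (\<omega> 0) = (0::ennreal)"
    by (subst (asm) nn_integral_0_iff_AE) (simp_all add: measurable_walk_measure)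
  then show ?thesis by (auto split: split_indicator_asm)
qed

text \<open>Markov property for weights that see the past only through staying in \<open>A\<close>.
  The weight ignores coordinate \<open>Suc s\<close>, so it leaves the inner integral.
  \<open>A = UNIV\<close> serves to confine the walk to the vertices, \<open>A = - {j}\<close> to
  follow it before it hits \<open>j\<close>.\<close>

lemma nn_integral_walk_measure_Suc:
  fixes f :: "'a \<Rightarrow> ennreal"
  shows "(\<integral>\<^sup>+\<omega>. of_bool (\<forall>t\<le>s. \<omega> t \<in> A) * f (\<omega> (Suc s)) \<partial>walk_measure G i) =
    (\<integral>\<^sup>+\<omega>. of_bool (\<forall>t\<le>s. \<omega> t \<in> A) *
      (\<integral>\<^sup>+w. f w \<partial>measure_pmf (pmf_of_set {w. (\<omega> s, w) \<in> parcs G})) \<partial>walk_measure G i)"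
proof -
  define g where "g \<omega> = of_bool (\<forall>t\<le>s. \<omega> t \<in> A) * f (\<omega> (Suc s))" for \<omega>
  let ?K = "\<lambda>v. measure_pmf (pmf_of_set {w. (v, w) \<in> parcs G})"
  \<comment> \<open>The one-step formula speaks of restricted trajectories; the event up to time
    \<open>s\<close> survives any restriction that keeps coordinate \<open>s\<close>.\<close>
  have past: "(\<forall>t\<le>s. restrict \<omega> {0..<m} t \<in> A) \<longleftrightarrow> (\<forall>t\<le>s. \<omega> t \<in> A)" if "s < m" for \<omega> m
    using that by auto
  have past_upd: "(\<forall>t\<le>s. (v(Suc s := x)) t \<in> A) \<longleftrightarrow> (\<forall>t\<le>s. v t \<in> A)" for v x
    by auto
  have g: "g \<in> borel_measurable (PiM {0..<Suc (Suc s)} (\<lambda>_. count_space UNIV))"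
  proof -
    let ?M = "PiM {0..<Suc (Suc s)} (\<lambda>_. count_space UNIV) :: (nat \<Rightarrow> 'a) measure"
    have "(\<lambda>\<omega>. \<omega> t) \<in> measurable ?M (count_space UNIV)" if "t \<le> Suc s" for t
      by (rule measurable_component_singleton) (use that in simp)
    note component = measurable_compose[OF this]
    have "Measurable.pred ?M (\<lambda>\<omega>. \<forall>t\<in>{..s}. \<omega> t \<in> A)"
      by (intro pred_intros_finite component) auto
    then have "(\<lambda>\<omega>. of_bool (\<forall>t\<in>{..s}. \<omega> t \<in> A) :: ennreal) \<in> borel_measurable ?M"
      by (rule measurable_compose) simp
    moreover have "(\<lambda>\<omega>. f (\<omega> (Suc s))) \<in> borel_measurable ?M"
      by (rule component) simp_all
    ultimately have "(\<lambda>\<omega>. of_bool (\<forall>t\<in>{..s}. \<omega> t \<in> A) * f (\<omega> (Suc s))) \<in> borel_measurable ?M"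
      by (rule borel_measurable_times_ennreal)
    then show ?thesis
      by (simp only: g_def[abs_def] Ball_def atMost_iff)
  qed
  have "(\<integral>\<^sup>+\<omega>. of_bool (\<forall>t\<le>s. \<omega> t \<in> A) * f (\<omega> (Suc s)) \<partial>walk_measure G i) =
      (\<integral>\<^sup>+\<omega>. g (restrict \<omega> {0..<Suc (Suc s)}) \<partial>walk.PF.lim G i)"
    unfolding g_def walk_measure_def by (subst past) simp_all
  also have "\<dots> = (\<integral>\<^sup>+\<omega>. \<integral>\<^sup>+x. g ((restrict \<omega> {0..<Suc s})(Suc s := x))
      \<partial>walk_kernel G i (Suc s) (restrict \<omega> {0..<Suc s}) \<partial>walk.PF.lim G i)"
    by (rule walk.nn_integral_lim_Suc[OF g])
  also have "\<dots> = (\<integral>\<^sup>+\<omega>. of_bool (\<forall>t\<le>s. \<omega> t \<in> A) * (\<integral>\<^sup>+w. f w \<partial>?K (\<omega> s)) \<partial>walk_measure G i)"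
    unfolding g_def walk_measure_def walk_kernel_def past_upd
    by (subst past) (simp_all add: nn_integral_cmult)
  finally show ?thesis .
qed

text \<open>The summand is 1 exactly for the times before the first visit, so the series counts
  them. Without a visit both sides are infinite, the left one as an infimum over the empty
  set.\<close>

lemma first_passage_eq_suminf:
  "first_passage j \<omega> = (\<Sum>s. of_bool (\<forall>t\<le>s. \<omega> t \<noteq> j))"
proof (cases "\<exists>t. \<omega> t = j")
  case True
  define T where "T = (LEAST t. \<omega> t = j)"
  have T: "\<omega> T = j" "\<And>t. \<omega> t = j \<Longrightarrow> T \<le> t"
    using True by (auto simp: T_def intro: LeastI Least_le)
  have "(\<forall>t\<le>s. \<omega> t \<noteq> j) \<longleftrightarrow> s \<in> {..<T}" for s
    using T by (force simp: not_le)
  then have "(\<Sum>s. of_bool (\<forall>t\<le>s. \<omega> t \<noteq> j)) = (\<Sum>s\<in>{..<T}. 1::ennreal)"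
    by (subst suminf_finite[of "{..<T}"]) auto
  moreover have "first_passage j \<omega> = of_nat T"
    unfolding first_passage_def
    by (rule antisym) (use T in \<open>auto intro: INF_lower INF_greatest\<close>)
  ultimately show ?thesis by simp
next
  case False
  then have "(\<Sum>s. of_bool (\<forall>t\<le>s. \<omega> t \<noteq> j)) = (\<Sum>s. 1::ennreal)"
    by simp
  also have "\<dots> = \<infinity>"
    by (simp add: suminf_eq_SUP ennreal_SUP_of_nat_eq_top)
  finally show ?thesis
    using False by (simp add: first_passage_def)
qed

lemma mean_first_passage_eq_suminf:
  "mean_first_passage G i j = (\<Sum>s. emeasure (walk_measure G i) {\<omega>. \<forall>t\<le>s. \<omega> t \<noteq> j})"
proof -
  note sets_walk_measure_avoid [measurable]
  have "mean_first_passage G i j =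
      (\<integral>\<^sup>+\<omega>. (\<Sum>s. indicator {\<omega>. \<forall>t\<le>s. \<omega> t \<noteq> j} \<omega>) \<partial>walk_measure G i)"
    unfolding mean_first_passage_def first_passage_eq_suminf
    by (intro nn_integral_cong suminf_cong) (simp add: indicator_def)
  then show ?thesis
    by (simp add: nn_integral_suminf)
qed

text \<open>Trajectories range over the whole type, while the step equation is known only at
  vertices. Induction on time works because the neighbour sets are finite and nonempty, so
  \<open>pmf_of_set\<close> really is uniform on them.\<close>

lemma AE_walk_measure_in_pverts:
  assumes G: "pair_graph G" and i: "i \<in> pverts G"
    and out: "\<And>v. v \<in> pverts G \<Longrightarrow> {w. (v, w) \<in> parcs G} \<noteq> {}"
  shows "AE \<omega> in walk_measure G i. \<forall>t. \<omega> t \<in> pverts G"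
proof -
  interpret pair_graph G by fact
  have nb: "finite {w. (v, w) \<in> parcs G}" "{w. (v, w) \<in> parcs G} \<subseteq> pverts G" for v
    by (auto intro: finite_subset[OF _ pair_finite_verts] simp: in_arcsD2)
  have "AE \<omega> in walk_measure G i. \<omega> s \<in> pverts G" for s
  proof (induction s)
    case 0
    then show ?case using AE_walk_measure_start[of i G] i by auto
  next
    case (Suc s)
    have "(\<integral>\<^sup>+\<omega>. indicator (- pverts G) (\<omega> (Suc s)) \<partial>walk_measure G i) =
      (\<integral>\<^sup>+\<omega>. (\<integral>\<^sup>+w. indicator (- pverts G) w
        \<partial>measure_pmf (pmf_of_set {w. (\<omega> s, w) \<in> parcs G})) \<partial>walk_measure G i)"
      using nn_integral_walk_measure_Suc[where s=s and A=UNIV and f="indicator (- pverts G)" and G=G and i=i] by simp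
    also have "\<dots> = (\<integral>\<^sup>+\<omega>. 0 \<partial>walk_measure G i)"
    proof (rule nn_integral_cong_AE)
      have "emeasure (measure_pmf (pmf_of_set {w. (v, w) \<in> parcs G})) (- pverts G) = 0"
        if "v \<in> pverts G" for v
      proof -
        have "{w. (v, w) \<in> parcs G} \<inter> - pverts G = {}"
          using nb(2)[of v] by blast
        then show ?thesis
        using nb(1)[of v] out[OF that] by (simp add: emeasure_pmf_of_set)
      qed
      then show "AE \<omega> in walk_measure G i. (\<integral>\<^sup>+w. indicator (- pverts G) w
          \<partial>measure_pmf (pmf_of_set {w. (\<omega> s, w) \<in> parcs G})) = 0"
        using Suc by auto
    qed
    finally have "(\<integral>\<^sup>+\<omega>. indicator (- pverts G) (\<omega> (Suc s)) \<partial>walk_measure G i) = (0::ennreal)"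
      by simp
    then have "AE \<omega> in walk_measure G i. indicator (- pverts G) (\<omega> (Suc s)) = (0::ennreal)"
      by (subst (asm) nn_integral_0_iff_AE)
        (simp_all add: measurable_walk_measure)
    then show ?case by (auto split: split_indicator_asm)
  qed
  then show ?thesis by (simp add: AE_all_countable)
qed

text \<open>The existence of such an \<open>h\<close> already forces the walk to hit
  \<open>j\<close> almost surely, so connectivity needs no separate argument.\<close>

lemma mean_first_passage_eqI:
  fixes h :: "'a \<Rightarrow> real"
  assumes G: "pair_graph G" and i: "i \<in> pverts G"
    and out: "\<And>v. v \<in> pverts G \<Longrightarrow> {w. (v, w) \<in> parcs G} \<noteq> {}"
    and h_nonneg: "\<And>v. v \<in> pverts G \<Longrightarrow> 0 \<le> h v" and hj: "h j = 0"
    and h: "\<And>v. v \<in> pverts G \<Longrightarrow> v \<noteq> j \<Longrightarrow>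
      h v = 1 + (\<Sum>w | (v, w) \<in> parcs G. h w) / card {w. (v, w) \<in> parcs G}"
  shows "mean_first_passage G i j = ennreal (h i)"
proof -
  interpret pair_graph G by fact
  interpret prob_space "walk_measure G i" by (rule prob_space_walk_measure)
  \<comment> \<open>\<open>E s\<close> is the event that \<open>j\<close> is hit after time
    \<open>s\<close>, \<open>p s\<close> its probability, and \<Phi> the expectation of
    \<open>h\<close> at the current position on that event.\<close>
  define E where "E s = {\<omega>::nat \<Rightarrow> 'a. \<forall>t\<le>s. \<omega> t \<noteq> j}" for s
  define p where "p s = prob (E s)" for s
  define \<Phi> where "\<Phi> s = (\<integral>\<^sup>+\<omega>. indicator (E s) \<omega> * ennreal (h (\<omega> s)) \<partial>walk_measure G i)" for s
  have stay: "AE \<omega> in walk_measure G i. \<forall>t. \<omega> t \<in> pverts G"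
    by (rule AE_walk_measure_in_pverts[OF G i out])
  have nb: "finite {w. (v, w) \<in> parcs G}" "{w. (v, w) \<in> parcs G} \<subseteq> pverts G" for v
    by (auto intro: finite_subset[OF _ pair_finite_verts] simp: in_arcsD2)
  have ind: "indicator (E s) \<omega> = (of_bool (\<forall>t\<le>s. \<omega> t \<in> - {j}) :: ennreal)" for s \<omega>
    by (simp add: E_def indicator_def)
  have [measurable]: "E s \<in> events" for s
    unfolding E_def by (rule sets_walk_measure_avoid)
  \<comment> \<open>The one-step equation integrated over \<open>E s\<close>, in additive form
    because subtraction in \<open>ennreal\<close> truncates.\<close>
  have step: "\<Phi> (Suc s) + ennreal (p s) = \<Phi> s" for s
  proof -
    let ?K = "\<lambda>v. measure_pmf (pmf_of_set {w. (v, w) \<in> parcs G})"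
    have K: "(\<integral>\<^sup>+w. ennreal (h w) \<partial>?K v) + 1 = ennreal (h v)" if v: "v \<in> pverts G" "v \<noteq> j" for v
    proof -
      have "(\<Sum>w | (v, w) \<in> parcs G. h w) \<ge> 0"
        using nb(2)[of v] h_nonneg by (intro sum_nonneg) auto
      then have nonneg: "(\<Sum>w | (v, w) \<in> parcs G. h w) / card {w. (v, w) \<in> parcs G} \<ge> 0"
        by (rule divide_nonneg_nonneg) simp
      have card: "real (card {w. (v, w) \<in> parcs G}) > 0"
        using nb(1)[of v] out[OF v(1)] by (simp add: card_gt_0_iff)
      have "(\<Sum>w | (v, w) \<in> parcs G. ennreal (h w)) =
          ennreal (\<Sum>w | (v, w) \<in> parcs G. h w)"
        using nb(2)[of v] h_nonneg by (intro sum_ennreal) auto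
      then have "(\<integral>\<^sup>+w. ennreal (h w) \<partial>?K v) =
          ennreal ((\<Sum>w | (v, w) \<in> parcs G. h w) / card {w. (v, w) \<in> parcs G})"
        using nb(1)[of v] out[OF v(1)] card \<open>(\<Sum>w | (v, w) \<in> parcs G. h w) \<ge> 0\<close>
        by (simp add: nn_integral_pmf_of_set divide_ennreal ennreal_of_nat_eq_real_of_nat)
      then show ?thesis
        unfolding h[OF v] using nonneg by (subst ennreal_plus) (simp_all add: add.commute)
    qed
    \<comment> \<open>\<open>E (Suc s)\<close> may be enlarged to \<open>E s\<close>: on the
      difference the walk is at \<open>j\<close> at time \<open>Suc s\<close>, where
      \<open>h\<close> vanishes.\<close>
    have "\<Phi> (Suc s) = (\<integral>\<^sup>+\<omega>. indicator (E s) \<omega> * ennreal (h (\<omega> (Suc s))) \<partial>walk_measure G i)"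
      unfolding \<Phi>_def
      by (intro nn_integral_cong) (use hj in \<open>auto simp: E_def le_Suc_eq split: split_indicator\<close>)
    also have "\<dots> = (\<integral>\<^sup>+\<omega>. indicator (E s) \<omega> *
        (\<integral>\<^sup>+w. ennreal (h w) \<partial>?K (\<omega> s)) \<partial>walk_measure G i)"
      unfolding ind by (rule nn_integral_walk_measure_Suc)
    finally have "\<Phi> (Suc s) + ennreal (p s) = (\<integral>\<^sup>+\<omega>. indicator (E s) \<omega> *
        (\<integral>\<^sup>+w. ennreal (h w) \<partial>?K (\<omega> s)) \<partial>walk_measure G i) +
        (\<integral>\<^sup>+\<omega>. indicator (E s) \<omega> \<partial>walk_measure G i)"
      by (simp add: p_def emeasure_eq_measure)
    also have "\<dots> = (\<integral>\<^sup>+\<omega>. indicator (E s) \<omega> *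
        (\<integral>\<^sup>+w. ennreal (h w) \<partial>?K (\<omega> s)) + indicator (E s) \<omega> \<partial>walk_measure G i)"
      by (rule nn_integral_add[symmetric])
        (simp_all add: measurable_walk_measure borel_measurable_times_ennreal)
    also have "\<dots> = \<Phi> s"
      unfolding \<Phi>_def
    proof (rule nn_integral_cong_AE)
      show "AE \<omega> in walk_measure G i. indicator (E s) \<omega> * (\<integral>\<^sup>+w. ennreal (h w) \<partial>?K (\<omega> s)) +
          indicator (E s) \<omega> = indicator (E s) \<omega> * ennreal (h (\<omega> s))"
        using stay
      proof eventually_elim
        case (elim \<omega>)
        show ?case
        proof (cases "\<omega> \<in> E s")
          case True
          then have "\<omega> s \<noteq> j" by (simp add: E_def)
          then show ?thesis using K[of "\<omega> s"] elim True by simp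
        qed simp
      qed
    qed
    finally show ?thesis .
  qed
  have \<Phi>0: "\<Phi> 0 = ennreal (h i)"
  proof -
    have "\<Phi> 0 = (\<integral>\<^sup>+\<omega>. ennreal (h i) \<partial>walk_measure G i)"
      unfolding \<Phi>_def
    proof (rule nn_integral_cong_AE)
      \<comment> \<open>If \<open>i = j\<close>, the indicator is 0 almost surely, and
        \<open>h i\<close> is 0 as well.\<close>
      show "AE \<omega> in walk_measure G i. indicator (E 0) \<omega> * ennreal (h (\<omega> 0)) = ennreal (h i)"
        using AE_walk_measure_start[of i G]
        by eventually_elim (simp add: E_def hj indicator_def)
    qed
    then show ?thesis using emeasure_space_1 by simp
  qed
  have sum: "(\<Sum>s<t. ennreal (p s)) + \<Phi> t = ennreal (h i)" for t
  proof (induction t)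
    case (Suc t)
    then show ?case by (simp add: add.assoc add.commute[of "ennreal (p t)"] step)
  qed (simp add: \<Phi>0)
  have "(\<Sum>s. ennreal (p s)) \<le> ennreal (h i)"
  proof (rule suminf_le_const)
    show "(\<Sum>s<t. ennreal (p s)) \<le> ennreal (h i)" for t
      unfolding sum[of t, symmetric] by simp
  qed auto
  then have "summable p"
    by (intro summable_suminf_not_top) (auto simp: p_def top_unique)
  then have p0: "p \<longlonglongrightarrow> 0" by (rule summable_LIMSEQ_zero)
  \<comment> \<open>The vertex set is finite, so its maximum bounds \<open>h\<close> along almost
    every trajectory.\<close>
  define B where "B = Max (h ` pverts G)"
  have \<Phi>_le: "\<Phi> t \<le> ennreal (B * p t)" for t
  proof -
    have "\<Phi> t \<le> (\<integral>\<^sup>+\<omega>. ennreal B * indicator (E t) \<omega> \<partial>walk_measure G i)"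
      unfolding \<Phi>_def
    proof (rule nn_integral_mono_AE)
      show "AE \<omega> in walk_measure G i.
          indicator (E t) \<omega> * ennreal (h (\<omega> t)) \<le> ennreal B * indicator (E t) \<omega>"
        using stay
      proof eventually_elim
        case (elim \<omega>)
        then have "h (\<omega> t) \<le> B" by (simp add: B_def)
        then show ?case by (simp add: indicator_def ennreal_leI)
      qed
    qed
    also have "\<dots> = ennreal (B * p t)"
      by (simp add: nn_integral_cmult emeasure_eq_measure p_def ennreal_mult'')
    finally show ?thesis .
  qed
  have "\<Phi> \<longlonglongrightarrow> 0"
  proof (rule tendsto_sandwich[of "\<lambda>_. 0" _ _ "\<lambda>t. ennreal (B * p t)"])
    show "(\<lambda>t. ennreal (B * p t)) \<longlonglongrightarrow> 0"
      using tendsto_ennrealI[OF tendsto_mult_right_zero[OF p0, of B]] by simp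
  qed (simp_all add: \<Phi>_le)
  then have "(\<lambda>t. (\<Sum>s<t. ennreal (p s)) + \<Phi> t) \<longlonglongrightarrow> (\<Sum>s. ennreal (p s)) + 0"
    by (intro tendsto_add summable_LIMSEQ) auto
  then have "(\<Sum>s. ennreal (p s)) = ennreal (h i)"
    unfolding sum by (simp add: LIMSEQ_const_iff)
  moreover have "emeasure (walk_measure G i) {\<omega>. \<forall>t\<le>s. \<omega> t \<noteq> j} = ennreal (p s)" for s
    unfolding p_def E_def by (rule emeasure_eq_measure)
  ultimately show ?thesis
    by (simp add: mean_first_passage_eq_suminf)
qed

section \<open>The stationary distribution\<close>

text \<open>Handshake count: over each undirected edge lie its two opposite arcs, which are distinct
  because there are no loops.\<close>

lemma (in pair_graph) card_parcs_eq: "card (parcs G) = 2 * card (undirected_edges G)"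
proof -
  have sym: "(v, u) \<in> parcs G" if "(u, v) \<in> parcs G" for u v
    using that by (rule graph_symmetric)
  have edges: "undirected_edges G = (\<lambda>(u, v). {u, v}) ` parcs G"
    by (auto simp: undirected_edges_def)
  have "card (parcs G) = (\<Sum>a\<in>parcs G. 1)" by simp
  also have "\<dots> = (\<Sum>e\<in>undirected_edges G. \<Sum>a\<in>{a \<in> parcs G. (\<lambda>(u, v). {u, v}) a = e}. 1)"
    unfolding edges by (rule sum.image_gen) simp
  also have "\<dots> = (\<Sum>e\<in>undirected_edges G. 2)"
  proof (rule sum.cong)
    fix e assume "e \<in> undirected_edges G"
    then obtain u v where e: "e = {u, v}" "(u, v) \<in> parcs G"
      by (auto simp: undirected_edges_def)
    have "u \<noteq> v" using no_loops'[of u v] e(2) by auto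
    have "{a \<in> parcs G. (\<lambda>(u, v). {u, v}) a = e} = {(u, v), (v, u)}"
      unfolding e(1)
    proof (intro equalityI subsetI)
      fix a assume "a \<in> {a \<in> parcs G. (\<lambda>(u, v). {u, v}) a = {u, v}}"
      then show "a \<in> {(u, v), (v, u)}"
        by (cases a) (simp add: doubleton_eq_iff)
    next
      fix a assume "a \<in> {(u, v), (v, u)}"
      then show "a \<in> {a \<in> parcs G. (\<lambda>(u, v). {u, v}) a = {u, v}}"
        using e(2) sym[OF e(2)] insert_commute[of u v "{}"] by (elim insertE emptyE) simp_all
    qed
    then show "(\<Sum>a\<in>{a \<in> parcs G. (\<lambda>(u, v). {u, v}) a = e}. 1) = (2::nat)"
      using \<open>u \<noteq> v\<close> by simp
  qed simp
  finally show ?thesis by simp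
qed

text \<open>Counting arcs by their tails turns twice the number of edges into the sum of degrees, so
  on a regular graph the weights are visibly uniform.\<close>

lemma (in pair_graph) stationary_eq:
  "stationary G v = card {w. (v, w) \<in> parcs G} / (\<Sum>u\<in>pverts G. real (card {w. (u, w) \<in> parcs G}))"
proof -
  have "out_arcs G u = Pair u ` {w. (u, w) \<in> parcs G}" for u
    by (auto simp: out_arcs_def)
  then have out: "out_degree G u = card {w. (u, w) \<in> parcs G}" for u
    by (simp add: out_degree_def card_image inj_on_def)
  have "parcs G = (SIGMA u:pverts G. {w. (u, w) \<in> parcs G})"
    by (auto simp: in_arcsD1)
  then have "card (parcs G) = card (SIGMA u:pverts G. {w. (u, w) \<in> parcs G})"
    by simp
  also have "\<dots> = (\<Sum>u\<in>pverts G. card {w. (u, w) \<in> parcs G})"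
    by (rule card_SigmaI) (auto intro: finite_subset[OF _ pair_finite_verts] simp: in_arcsD2)
  finally have "card (parcs G) = (\<Sum>u\<in>pverts G. card {w. (u, w) \<in> parcs G})" .
  then have "2 * real (card (undirected_edges G)) = (\<Sum>u\<in>pverts G. real (card {w. (u, w) \<in> parcs G}))"
    using card_parcs_eq by (simp flip: of_nat_sum)
  then show ?thesis
    by (simp only: stationary_def out)
qed

section \<open>Random walk on the cube\<close>

lemma pverts_cube_graph: "pverts (cube_graph n) = (\<Pi>\<^sub>E m\<in>{1..n}. {0, 1})"
proof -
  have "{0..<2::int} = {0, 1}" by auto
  then show ?thesis
    by (simp add: cube_graph_def cayley_graph_def cube_group_def carrier_integer_mod_group)
qed

lemma card_pverts_cube_graph: "card (pverts (cube_graph n)) = 2 ^ n"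
  by (simp add: pverts_cube_graph card_PiE numeral_2_eq_2)

text \<open>Adding the generator whose 1 sits at \<open>m\<close> flips bit \<open>m\<close>, and on
  the integers 0 and 1 the flip is \<open>1 - v m\<close>. This replaces group arithmetic modulo 2
  by function updates.\<close>

lemma cube_graph_nbrs:
  assumes v: "v \<in> pverts (cube_graph n)"
  shows "{w. (v, w) \<in> parcs (cube_graph n)} = (\<lambda>m. v(m := 1 - v m)) ` {1..n}"
proof -
  have car: "carrier (cube_group n) = (\<Pi>\<^sub>E m\<in>{1..n}. {0, 1})"
    using pverts_cube_graph[of n] by (simp add: cube_graph_def cayley_graph_def)
  have mult: "x \<otimes>\<^bsub>cube_group n\<^esub> y = (\<lambda>m\<in>{1..n}. (x m + y m) mod 2)" for x y
    by (simp add: cube_group_def)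
  note v = v[unfolded pverts_cube_graph]
  have v01: "v k = 0 \<or> v k = 1" if "k \<in> {1..n}" for k
    using PiE_mem[OF v that] by simp
  have flip: "v \<otimes>\<^bsub>cube_group n\<^esub> s = v(m := 1 - v m)"
    if s: "m \<in> {1..n}" "s m = 1" "\<And>k. k \<in> {1..n} \<Longrightarrow> k \<noteq> m \<Longrightarrow> s k = 0" for s m
  proof
    fix k
    show "(v \<otimes>\<^bsub>cube_group n\<^esub> s) k = (v(m := 1 - v m)) k"
      using v01[of k] s PiE_arb[OF v, of k] by (auto simp: mult)
  qed
  have mem: "v(m := 1 - v m) \<in> carrier (cube_group n)" if "m \<in> {1..n}" for m
    using v that v01[OF that] unfolding car by (auto simp: PiE_iff extensional_def)
  have gens: "(\<exists>s\<in>cube_gens n. w = v \<otimes>\<^bsub>cube_group n\<^esub> s) \<longleftrightarrow> (\<exists>m\<in>{1..n}. w = v(m := 1 - v m))" for w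
  proof
    assume "\<exists>s\<in>cube_gens n. w = v \<otimes>\<^bsub>cube_group n\<^esub> s"
    then obtain s where s: "s \<in> cube_gens n" "w = v \<otimes>\<^bsub>cube_group n\<^esub> s" by blast
    then obtain m where m: "m \<in> {1..n}" "s m = 1" "\<And>k. k \<in> {1..n} \<Longrightarrow> s k = 1 \<Longrightarrow> k = m"
      unfolding cube_gens_def by blast
    have "s k = 0" if "k \<in> {1..n}" "k \<noteq> m" for k
      using s(1) m(3)[OF that(1)] that PiE_mem[of s "{1..n}" "\<lambda>_. {0, 1}" k]
      by (auto simp: cube_gens_def car)
    then show "\<exists>m\<in>{1..n}. w = v(m := 1 - v m)"
      using flip[of m s] m s(2) by blast
  next
    assume "\<exists>m\<in>{1..n}. w = v(m := 1 - v m)"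
    then obtain m where m: "m \<in> {1..n}" "w = v(m := 1 - v m)" by blast
    \<comment> \<open>The unit vector at \<open>m\<close>, restricted to \<open>{1..n}\<close> so
      that it is extensional and lies in the carrier.\<close>
    define s where "s = (\<lambda>k\<in>{1..n}. if k = m then 1 else 0 :: int)"
    have "s \<in> cube_gens n"
      using m(1) by (auto simp: cube_gens_def car s_def)
    moreover have "w = v \<otimes>\<^bsub>cube_group n\<^esub> s"
      using flip[of m s] m by (simp add: s_def)
    ultimately show "\<exists>s\<in>cube_gens n. w = v \<otimes>\<^bsub>cube_group n\<^esub> s" by blast
  qed
  have "{w. (v, w) \<in> parcs (cube_graph n)} =
      {w \<in> carrier (cube_group n). \<exists>s\<in>cube_gens n. w = v \<otimes>\<^bsub>cube_group n\<^esub> s}"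
    using v by (auto simp: cube_graph_def cayley_graph_def car)
  then show ?thesis
    using mem by (auto simp: gens)
qed

text \<open>Each flip changes its own coordinate, since \<open>1 - x = x\<close> has no integer
  solution. Sums over neighbours thereby become sums over coordinates.\<close>

lemma inj_flip: "inj_on (\<lambda>m. v(m := 1 - v m :: int)) A"
proof (rule inj_onI)
  fix m k assume eq: "v(m := 1 - v m) = v(k := 1 - v k)"
  show "m = k"
  proof (rule ccontr)
    assume "m \<noteq> k"
    then have "1 - v m = v m" using fun_cong[OF eq, of m] by simp
    then show False by presburger
  qed
qed

lemma card_cube_graph_nbrs:
  "v \<in> pverts (cube_graph n) \<Longrightarrow> card {w. (v, w) \<in> parcs (cube_graph n)} = n"
  by (simp add: cube_graph_nbrs card_image[OF inj_flip])

lemma stationary_cube_graph: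
  assumes "n \<ge> 1" "v \<in> pverts (cube_graph n)"
  shows "stationary (cube_graph n) v = 1 / 2 ^ n"
proof -
  show ?thesis
    using assms card_pverts_cube_graph[of n] pair_graph.stationary_eq[OF pair_graph_cube_graph]
    by (simp add: card_cube_graph_nbrs)
qed

section \<open>Characters: eigenvalues and orthogonality\<close>

text \<open>The factor \<open>1 - 2 * v m\<close> is \<open>(-1) ^ v m\<close> for bits, so this is the character \<open>\<chi>\<^sub>S\<close>.\<close>

definition cube_char :: "nat set \<Rightarrow> (nat \<Rightarrow> int) \<Rightarrow> real" where
  "cube_char S v = (\<Prod>m\<in>S. of_int (1 - 2 * v m))"

lemma cube_char_values:
  assumes "v \<in> pverts (cube_graph n)" "S \<subseteq> {1..n}"
  shows "cube_char S v = 1 \<or> cube_char S v = -1"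
proof -
  have "\<bar>cube_char S v\<bar> = (\<Prod>m\<in>S. \<bar>of_int (1 - 2 * v m)\<bar>)"
    unfolding cube_char_def by (rule abs_prod)
  also have "\<dots> = (\<Prod>m\<in>S. 1)"
  proof (rule prod.cong)
    fix m assume "m \<in> S"
    then have "v m = 0 \<or> v m = 1"
      using assms by (auto simp: pverts_cube_graph PiE_iff)
    then show "\<bar>of_int (1 - 2 * v m) :: real\<bar> = 1" by auto
  qed simp
  finally show ?thesis by auto
qed

text \<open>Flipping bit \<open>m\<close> negates the character if \<open>m\<close> is in
  \<open>S\<close> and fixes it otherwise, so \<open>card S\<close> of the \<open>n\<close> signs
  are negative.\<close>

lemma sum_cube_char_flip:
  assumes S: "S \<subseteq> {1..n}"
  shows "(\<Sum>m=1..n. cube_char S (v(m := 1 - v m))) = (real n - 2 * real (card S)) * cube_char S v"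
proof -
  have fin: "finite S" using S by (rule finite_subset) simp
  have "cube_char S (v(m := 1 - v m)) = (if m \<in> S then -1 else 1) * cube_char S v" for m
  proof (cases "m \<in> S")
    case True
    then show ?thesis
      using fin by (simp add: cube_char_def prod.remove[of S m] algebra_simps)
  next
    case False
    then show ?thesis
      by (auto simp: cube_char_def intro!: prod.cong)
  qed
  then have "(\<Sum>m=1..n. cube_char S (v(m := 1 - v m))) =
      (\<Sum>m=1..n. (if m \<in> S then -1 else 1)) * cube_char S v"
    by (simp add: sum_distrib_right)
  also have "(\<Sum>m=1..n. (if m \<in> S then -1 else 1 :: real)) = (\<Sum>m=1..n. 1 - 2 * of_bool (m \<in> S))"
    by (intro sum.cong) auto
  also have "\<dots> = real n - 2 * real (card ({1..n} \<inter> S))"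
    by (simp add: sum_subtractf flip: sum_distrib_left)
  also have "{1..n} \<inter> S = S" using S by blast
  finally show ?thesis .
qed

text \<open>The sum over subsets is the expansion of a product of factors
  \<open>1 + a m * b m\<close> over the coordinates, where \<open>a m\<close> and \<open>b m\<close>
  are the signs of \<open>v\<close> and \<open>j\<close>. A coordinate where they differ gives the
  factor 0.\<close>

lemma sum_Pow_cube_char:
  assumes "v \<in> pverts (cube_graph n)" "j \<in> pverts (cube_graph n)" "v \<noteq> j"
  shows "(\<Sum>S\<in>Pow {1..n}. cube_char S v * cube_char S j) = 0"
proof -
  note vj = assms(1,2)[unfolded pverts_cube_graph]
  obtain m where m: "m \<in> {1..n}" "v m \<noteq> j m"
    using PiE_ext[OF vj] assms(3) by blast
  have "(\<Sum>S\<in>Pow {1..n}. cube_char S v * cube_char S j) =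
      (\<Sum>S\<in>Pow {1..n}. \<Prod>m\<in>S. of_int (1 - 2 * v m) * of_int (1 - 2 * j m))"
    by (simp add: cube_char_def prod.distrib)
  also have "\<dots> = (\<Prod>m=1..n. of_int (1 - 2 * v m) * of_int (1 - 2 * j m) + 1)"
    by (simp add: prod_add)
  also have "\<dots> = 0"
    using m PiE_mem[OF vj(1) m(1)] PiE_mem[OF vj(2) m(1)]
    by (intro prod_zero) (auto intro!: bexI[of _ m])
  finally show ?thesis .
qed

lemma sum_pverts_cube_char:
  assumes "S \<subseteq> {1..n}" "S \<noteq> {}"
  shows "(\<Sum>v\<in>pverts (cube_graph n). cube_char S v) = 0"
proof -
  obtain m where m: "m \<in> S" using assms by blast
  have "(\<Sum>v\<in>pverts (cube_graph n). cube_char S v) =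
      (\<Sum>v\<in>(\<Pi>\<^sub>E m\<in>{1..n}. {0, 1}). \<Prod>m=1..n. if m \<in> S then of_int (1 - 2 * v m) else 1)"
    using assms by (simp add: cube_char_def pverts_cube_graph prod.If_cases Int_absorb1)
  also have "\<dots> = (\<Prod>m=1..n. \<Sum>x\<in>{0, 1}. if m \<in> S then of_int (1 - 2 * x) else 1)"
    by (rule prod_sum_PiE[symmetric]) auto
  also have "\<dots> = 0"
    using m assms by (intro prod_zero) (auto intro!: bexI[of _ m])
  finally show ?thesis .
qed

text \<open>Spectral solution of the step equation: each coefficient is the inverse of
  \<open>1 - eigenvalue\<close>, that is of \<open>2 * card S / n\<close>. The empty set is left out
  because its eigenvalue is 1, and subtracting from 1 makes the value at \<open>v = j\<close>
  zero.\<close>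

definition cube_hitting :: "nat \<Rightarrow> (nat \<Rightarrow> int) \<Rightarrow> (nat \<Rightarrow> int) \<Rightarrow> real" where
  "cube_hitting n j v =
    (\<Sum>S\<in>Pow {1..n} - {{}}. real n / (2 * real (card S)) * (1 - cube_char S v * cube_char S j))"

lemma cube_hitting_nonneg:
  assumes "v \<in> pverts (cube_graph n)" "j \<in> pverts (cube_graph n)"
  shows "0 \<le> cube_hitting n j v"
  unfolding cube_hitting_def
proof (intro sum_nonneg mult_nonneg_nonneg)
  fix S assume "S \<in> Pow {1..n} - {{}}"
  then show "0 \<le> 1 - cube_char S v * cube_char S j"
    using cube_char_values[OF assms(1), of S] cube_char_values[OF assms(2), of S] by auto
qed simp

lemma cube_hitting_step:
  assumes n: "n \<ge> 1" and v: "v \<in> pverts (cube_graph n)" and j: "j \<in> pverts (cube_graph n)"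
    and "v \<noteq> j"
  shows "cube_hitting n j v = 1 + (\<Sum>m=1..n. cube_hitting n j (v(m := 1 - v m))) / n"
proof -
  let ?P = "Pow {1..n} - {{}} :: nat set set"
  let ?c = "\<lambda>S. real n / (2 * real (card S))"
  have "(\<Sum>m=1..n. cube_hitting n j (v(m := 1 - v m))) =
      (\<Sum>S\<in>?P. \<Sum>m=1..n. ?c S * (1 - cube_char S (v(m := 1 - v m)) * cube_char S j))"
    unfolding cube_hitting_def by (rule sum.swap)
  also have "\<dots> = (\<Sum>S\<in>?P. n * (?c S * (1 - cube_char S v * cube_char S j)) +
      n * (cube_char S v * cube_char S j))"
  proof (rule sum.cong)
    fix S assume S: "S \<in> ?P"
    then have "card S \<noteq> 0" by (auto dest: finite_subset)
    have "(\<Sum>m=1..n. ?c S * (1 - cube_char S (v(m := 1 - v m)) * cube_char S j)) =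
        ?c S * (n - (\<Sum>m=1..n. cube_char S (v(m := 1 - v m))) * cube_char S j)"
      by (simp only: sum_distrib_left[symmetric] sum_subtractf sum_distrib_right) simp
    also have "(\<Sum>m=1..n. cube_char S (v(m := 1 - v m))) = (real n - 2 * real (card S)) * cube_char S v"
      using S by (intro sum_cube_char_flip) auto
    \<comment> \<open>The coefficient times the eigenvalue deficit \<open>2 * card S\<close> is
      \<open>n\<close> for every \<open>S\<close>; the surplus is thus a plain character
      sum.\<close>
    also have "?c S * (n - (real n - 2 * real (card S)) * cube_char S v * cube_char S j) =
        n * (?c S * (1 - cube_char S v * cube_char S j)) + n * (cube_char S v * cube_char S j)"
      using \<open>card S \<noteq> 0\<close> by (simp add: field_simps)
    finally show "(\<Sum>m=1..n. ?c S * (1 - cube_char S (v(m := 1 - v m)) * cube_char S j)) =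
        n * (?c S * (1 - cube_char S v * cube_char S j)) + n * (cube_char S v * cube_char S j)" .
  qed simp
  also have "\<dots> = n * cube_hitting n j v + n * (\<Sum>S\<in>?P. cube_char S v * cube_char S j)"
    by (simp add: cube_hitting_def sum.distrib sum_distrib_left)
  \<comment> \<open>The full character sum is 0 and its empty-set term is 1. This -1 yields the unit
    cost of one step.\<close>
  also have "(\<Sum>S\<in>?P. cube_char S v * cube_char S j) = -1"
    using sum_Pow_cube_char[OF v j \<open>v \<noteq> j\<close>] by (simp add: sum_diff1 cube_char_def)
  finally have sum: "(\<Sum>m=1..n. cube_hitting n j (v(m := 1 - v m))) = real n * cube_hitting n j v + real n * - 1" .
  show ?thesis unfolding sum using n by (simp add: field_simps)
qed

lemma mean_first_passage_cube_graph:
  assumes n: "n \<ge> 1" and i: "i \<in> pverts (cube_graph n)" and j: "j \<in> pverts (cube_graph n)"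
  shows "mean_first_passage (cube_graph n) i j = ennreal (cube_hitting n j i)"
proof (rule mean_first_passage_eqI[OF pair_graph_cube_graph i])
  show "{w. (v, w) \<in> parcs (cube_graph n)} \<noteq> {}" if "v \<in> pverts (cube_graph n)" for v
    using n that by (simp add: cube_graph_nbrs)
  show "0 \<le> cube_hitting n j v" if "v \<in> pverts (cube_graph n)" for v
    using that j by (rule cube_hitting_nonneg)
  have "cube_char S j * cube_char S j = 1" if "S \<subseteq> {1..n}" for S
    using cube_char_values[OF j that] by auto
  then show "cube_hitting n j j = 0"
    by (simp add: cube_hitting_def)
  fix v assume v: "v \<in> pverts (cube_graph n)" "v \<noteq> j"
  then show "cube_hitting n j v = 1 + (\<Sum>w | (v, w) \<in> parcs (cube_graph n). cube_hitting n j w) /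
      card {w. (v, w) \<in> parcs (cube_graph n)}"
    using cube_hitting_step[OF n v(1) j v(2)]
    by (simp add: cube_graph_nbrs sum.reindex[OF inj_flip] card_image[OF inj_flip])
qed

section \<open>Averaging the hitting times over the target\<close>

theorem proposition4p1:
  fixes n :: nat and i :: "nat \<Rightarrow> int"
  assumes "n \<ge> 1" and "i \<in> pverts (cube_graph n)"
  shows "eigentime (cube_graph n) i =
    ennreal (\<Sum>k=1..n. real n * real (n choose k) / (2 * real k))"
proof -
  let ?V = "pverts (cube_graph n)" and ?P = "Pow {1..n} - {{}} :: nat set set"
  let ?c = "\<lambda>S. real n / (2 * real (card S))"
  have nonneg: "0 \<le> cube_hitting n j i" if j: "j \<in> ?V" for j
    using assms(2) j by (rule cube_hitting_nonneg)
  have "eigentime (cube_graph n) i = (\<Sum>j\<in>?V. ennreal (1 / 2 ^ n * cube_hitting n j i))"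
    unfolding eigentime_def using assms nonneg
    by (intro sum.cong)
      (simp_all add: stationary_cube_graph mean_first_passage_cube_graph flip: ennreal_mult)
  also have "\<dots> = ennreal (\<Sum>j\<in>?V. 1 / 2 ^ n * cube_hitting n j i)"
    using nonneg by (intro sum_ennreal) simp
  also have "(\<Sum>j\<in>?V. 1 / 2 ^ n * cube_hitting n j i) = 1 / 2 ^ n * (\<Sum>j\<in>?V. cube_hitting n j i)"
    by (rule sum_distrib_left[symmetric])
  also have "(\<Sum>j\<in>?V. cube_hitting n j i) =
      (\<Sum>S\<in>?P. \<Sum>j\<in>?V. ?c S * (1 - cube_char S i * cube_char S j))"
    unfolding cube_hitting_def by (rule sum.swap)
  also have "1 / 2 ^ n * \<dots> = (\<Sum>S\<in>?P. ?c S)"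
  proof -
    \<comment> \<open>The nontrivial character sums to 0 over the targets \<open>j\<close>, which
      removes the dependence on \<open>i\<close>. The remaining \<open>2 ^ n\<close> cancels the
      uniform stationary weight.\<close>
    have "(\<Sum>j\<in>?V. ?c S * (1 - cube_char S i * cube_char S j)) = 2 ^ n * ?c S" if "S \<in> ?P" for S
    proof -
      have "(\<Sum>j\<in>?V. ?c S * (1 - cube_char S i * cube_char S j)) =
          ?c S * (2 ^ n - cube_char S i * (\<Sum>j\<in>?V. cube_char S j))"
        by (simp only: sum_distrib_left[symmetric] sum_subtractf) (simp add: card_pverts_cube_graph)
      then show ?thesis
        using that sum_pverts_cube_char[of S n] by simp
    qed
    then show ?thesis by (simp add: sum_divide_distrib)
  qed
  \<comment> \<open>The coefficient depends on \<open>S\<close> only through its size, so subsets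
    are grouped by cardinality, which starts at 1 without the empty set.\<close>
  also have "\<dots> = (\<Sum>k=1..n. \<Sum>S | S \<in> ?P \<and> card S = k. ?c S)"
  proof (rule sum.group[symmetric])
    show "card ` ?P \<subseteq> {1..n}"
      using card_mono[of "{1..n}"] by (auto simp: Suc_le_eq card_gt_0_iff dest: finite_subset)
  qed auto
  also have "\<dots> = (\<Sum>k=1..n. real n * real (n choose k) / (2 * real k))"
  proof (rule sum.cong)
    fix k assume k: "k \<in> {1..n}"
    then have "{S. S \<in> ?P \<and> card S = k} = {S. S \<subseteq> {1..n} \<and> card S = k}"
      by auto
    then have "card {S. S \<in> ?P \<and> card S = k} = n choose k"
      using n_subsets[of "{1..n}" k] by simp
    then show "(\<Sum>S | S \<in> ?P \<and> card S = k. ?c S) = real n * real (n choose k) / (2 * real k)"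
      by simp
  qed simp
  finally show ?thesis .
qed

end
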